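(* If $T$ is a (finite) tree, then there is a decomposition of $T$ into UBVTs such that each vertex $v\in V(T)$ lies in at most $\lceil (d(v)+1)/3\rceil$ elements of the decomposition. Consequently $ub(T)\le \lceil (\Delta(T)+1)/3\rceil$.
   Context: A bar is a closed horizontal line segment of length $1$ in the plane. Two bars of an arrangement of pairwise disjoint bars see each other if there is an axis-parallel rectangle of positive width whose bottom side lies in one of them, whose top side lies in the other, and whose interior meets no bar of the arrangement. For a nonnegative integer $t$, a $t$-unit-bar visibility representation of a graph $G$ assigns to each vertex a set of at most $t$ bars, all bars pairwise disjoint, such that two distinct vertices are adjacent iff some bar of one sees some bar of the other; $ub(G)$ is the minimum such $t$. A unit bar visibility tree (UBVT) is a tree having a $1$-unit-bar visibility representation. A decomposition of $T$ into UBVTs is a collection of subtrees of $T$, each a UBVT, whose edge sets partition $E(T)$; a vertex lies in an element if it is a vertex of that subtree. $d(v)$ is the degree of $v$ in $T$ and $\Delta(T)$ the maximum degree. *)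

theory Defs
  imports
    Complex_Main
    "HOL-Library.Disjoint_Sets"
    "HOL-Library.Extended_Nat"
    "Graph_Theory.Digraph_Component"
begin

text \<open>
  Finite simple graphs are the symmetric loop-free digraphs of \<^locale>\<open>pair_graph\<close>: an edge
  \<open>uv\<close> is the pair of arcs \<open>(u,v)\<close>, \<open>(v,u)\<close>, so the degree of \<open>v\<close> is its out-degree.
  The constants \<open>tree\<close> and \<open>forest\<close> of Graph_Theory are not usable under this encoding, because they
  count the closed walk \<open>u, v, u\<close> along a single edge as a cycle. The cycles of the
  undirected graph are the cycles of length at least 3.
\<close>

definition undirected_tree :: "'a pair_pre_digraph \<Rightarrow> bool" where
  "undirected_tree T \<longleftrightarrow>
     pair_graph T \<and> connected (with_proj T) \<and>
     \<not> (\<exists>p. pre_digraph.cycle (with_proj T) p \<and> length p \<ge> 3)"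

definition max_degree :: "'a pair_pre_digraph \<Rightarrow> nat" where
  "max_degree G = Max (out_degree (with_proj G) ` pverts G)"

definition unit_bar :: "(real \<times> real) set \<Rightarrow> bool" where
  "unit_bar b \<longleftrightarrow> (\<exists>x y. b = {x..x + 1} \<times> {y})"

definition sees :: "(real \<times> real) set set \<Rightarrow> (real \<times> real) set \<Rightarrow> (real \<times> real) set \<Rightarrow> bool" where
  "sees \<B> b c \<longleftrightarrow>
     (\<exists>x1 x2 y1 y2. x1 < x2 \<and> y1 < y2 \<and>
        ({x1..x2} \<times> {y1} \<subseteq> b \<and> {x1..x2} \<times> {y2} \<subseteq> c \<or>
         {x1..x2} \<times> {y1} \<subseteq> c \<and> {x1..x2} \<times> {y2} \<subseteq> b) \<and>
        (\<forall>d\<in>\<B>. ({x1<..<x2} \<times> {y1<..<y2}) \<inter> d = {}))"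

definition unit_bar_rep ::
  "nat \<Rightarrow> 'a pair_pre_digraph \<Rightarrow> ('a \<Rightarrow> (real \<times> real) set set) \<Rightarrow> bool" where
  "unit_bar_rep t G R \<longleftrightarrow>
     (\<forall>v\<in>pverts G. finite (R v) \<and> card (R v) \<le> t \<and> (\<forall>b\<in>R v. unit_bar b)) \<and>
     (\<forall>u\<in>pverts G. \<forall>v\<in>pverts G. \<forall>b\<in>R u. \<forall>c\<in>R v. (u, b) \<noteq> (v, c) \<longrightarrow> b \<inter> c = {}) \<and>
     (\<forall>u\<in>pverts G. \<forall>v\<in>pverts G. u \<noteq> v \<longrightarrow>
        ((u, v) \<in> parcs G \<longleftrightarrow> (\<exists>b\<in>R u. \<exists>c\<in>R v. sees (\<Union>w\<in>pverts G. R w) b c)))"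

text \<open>Valued in \<^typ>\<open>enat\<close> so that the value is \<open>\<infinity>\<close> should no representation exist.\<close>

definition ub :: "'a pair_pre_digraph \<Rightarrow> enat" where
  "ub G = (INF t\<in>{t. \<exists>R. unit_bar_rep t G R}. enat t)"

definition ubvt :: "'a pair_pre_digraph \<Rightarrow> bool" where
  "ubvt T \<longleftrightarrow> undirected_tree T \<and> (\<exists>R. unit_bar_rep 1 T R)"

text \<open>One-vertex subtrees, with empty edge set, are allowed as elements.\<close>

definition ubvt_decomposition :: "'a pair_pre_digraph set \<Rightarrow> 'a pair_pre_digraph \<Rightarrow> bool" where
  "ubvt_decomposition \<D> T \<longleftrightarrow>
     (\<forall>H\<in>\<D>. subgraph (with_proj H) (with_proj T) \<and> ubvt H) \<and>
     disjoint_family_on parcs \<D> \<and> (\<Union>H\<in>\<D>. parcs H) = parcs T"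

end

theory Submission
  imports Defs
begin

text \<open>
  Root the tree. At a non-root vertex the element containing the edge to the parent is continued
  along one child edge, and the remaining child edges are grouped in threes, each group starting new
  elements centred at that vertex; at the root all edges are grouped in threes. A vertex of degree
  \<open>d\<close> then lies in at most \<open>1 + \<lceil>(d - 2) / 3\<rceil> = \<lceil>(d + 1) / 3\<rceil>\<close> elements, and every element is a spider with
  at most three legs. Such a spider is a UBVT: stack one leg above the centre bar and hang the other
  two below its two ends. Placing the representations of all elements side by side gives the bound
  on \<open>ub T\<close>.
\<close>

section \<open>Bars at integer heights\<close>

text \<open>Integer heights leave no room for a bar strictly between consecutive levels, so
  visibility between neighbouring levels does not depend on the other bars.\<close>

definition lattice_bar :: "real \<Rightarrow> int \<Rightarrow> (real \<times> real) set" where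
  "lattice_bar x y = {x..x + 1} \<times> {real_of_int y}"

lemma unit_bar_lattice_bar: "unit_bar (lattice_bar x y)"
  unfolding unit_bar_def lattice_bar_def by blast

lemma lattice_bar_disjoint:
  assumes "y \<noteq> y' \<or> \<bar>x - x'\<bar> > 1"
  shows "lattice_bar x y \<inter> lattice_bar x' y' = {}"
  using assms by (auto simp: lattice_bar_def abs_if split: if_splits)

lemma sees_sym: "sees \<B> b c \<longleftrightarrow> sees \<B> c b"
  unfolding sees_def by (simp only: disj_commute)

text \<open>The two intervals overlap in positive width, and the rectangle over the whole overlap is
  unobstructed because no integer lies strictly between consecutive levels.\<close>

lemma sees_lattice_barI:
  assumes bars: "\<And>d. d \<in> \<B> \<Longrightarrow> \<exists>x y. d = lattice_bar x y"
    and "\<bar>x - x'\<bar> < 1" "\<bar>y - y'\<bar> = 1"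
  shows "sees \<B> (lattice_bar x y) (lattice_bar x' y')"
proof -
  have *: "sees \<B> (lattice_bar x y) (lattice_bar x' (y + 1))" if "\<bar>x - x'\<bar> < 1" for x x' y
    unfolding sees_def
  proof (intro exI conjI ballI)
    show "max x x' < min x x' + 1" using that by linarith
    show "real_of_int y < real_of_int (y + 1)" by simp
    show "{max x x'..min x x' + 1} \<times> {real_of_int y} \<subseteq> lattice_bar x y \<and>
        {max x x'..min x x' + 1} \<times> {real_of_int (y + 1)} \<subseteq> lattice_bar x' (y + 1) \<or>
        {max x x'..min x x' + 1} \<times> {real_of_int y} \<subseteq> lattice_bar x' (y + 1) \<and>
        {max x x'..min x x' + 1} \<times> {real_of_int (y + 1)} \<subseteq> lattice_bar x y"
      by (auto simp: lattice_bar_def)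
    fix d assume "d \<in> \<B>"
    then obtain a b where d: "d = lattice_bar a b" using bars by blast
    have "\<not> (real_of_int y < real_of_int b \<and> real_of_int b < real_of_int (y + 1))"
      by (simp only: of_int_less_iff) linarith
    then show "{max x x'<..<min x x' + 1} \<times> {real_of_int y<..<real_of_int (y + 1)} \<inter> d = {}"
      unfolding d lattice_bar_def by auto
  qed
  consider "y' = y + 1" | "y = y' + 1" using assms(3) by linarith
  then show ?thesis
    using *[of x x' y] *[of x' x y'] assms(2) sees_sym by cases (auto simp: abs_minus_commute)
qed

text \<open>The horizontal range of the rectangle lies in the intervals of both bars. A bar at an
  intermediate height with the same left end as either of them spans that whole range and would cut
  the rectangle.\<close>

lemma sees_lattice_barD:
  assumes "sees \<B> (lattice_bar x y) (lattice_bar x' y')"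
  shows "\<bar>x - x'\<bar> < 1" "y \<noteq> y'"
    and "lattice_bar x'' y'' \<in> \<B> \<Longrightarrow> min y y' < y'' \<Longrightarrow> y'' < max y y' \<Longrightarrow> x'' \<noteq> x \<and> x'' \<noteq> x'"
proof -
  obtain x1 x2 y1 y2 where "x1 < x2" "y1 < y2" and
    sub: "{x1..x2} \<times> {y1} \<subseteq> lattice_bar x y \<and> {x1..x2} \<times> {y2} \<subseteq> lattice_bar x' y' \<or>
      {x1..x2} \<times> {y1} \<subseteq> lattice_bar x' y' \<and> {x1..x2} \<times> {y2} \<subseteq> lattice_bar x y" and
    empty: "\<forall>d\<in>\<B>. ({x1<..<x2} \<times> {y1<..<y2}) \<inter> d = {}"
    using assms unfolding sees_def by blast
  have in_bar: "a \<le> x1 \<and> x2 \<le> a + 1 \<and> y0 = real_of_int b"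
    if "{x1..x2} \<times> {y0} \<subseteq> lattice_bar a b" for y0 a b
  proof -
    have "(x1, y0) \<in> lattice_bar a b" "(x2, y0) \<in> lattice_bar a b"
      using that \<open>x1 < x2\<close> by auto
    then show ?thesis by (auto simp: lattice_bar_def)
  qed
  have "x \<le> x1 \<and> x2 \<le> x + 1 \<and> x' \<le> x1 \<and> x2 \<le> x' + 1 \<and>
      (y1 = real_of_int y \<and> y2 = real_of_int y' \<or> y1 = real_of_int y' \<and> y2 = real_of_int y)"
    using sub by (elim disjE conjE) (drule in_bar, drule in_bar, simp)+
  then have x: "x \<le> x1" "x2 \<le> x + 1" "x' \<le> x1" "x2 \<le> x' + 1"
    and y: "y1 = real_of_int (min y y')" "y2 = real_of_int (max y y')"
    using \<open>y1 < y2\<close> by auto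
  show "\<bar>x - x'\<bar> < 1" "y \<noteq> y'" using x y \<open>x1 < x2\<close> \<open>y1 < y2\<close> by linarith+
  show "x'' \<noteq> x \<and> x'' \<noteq> x'"
    if "lattice_bar x'' y'' \<in> \<B>" "min y y' < y''" "y'' < max y y'"
  proof -
    have "((x1 + x2) / 2, real_of_int y'') \<in> {x1<..<x2} \<times> {y1<..<y2}"
      using that(2,3) \<open>x1 < x2\<close> unfolding y by (simp only: mem_Times_iff) simp
    then have "((x1 + x2) / 2, real_of_int y'') \<notin> lattice_bar x'' y''"
      using empty that(1) by blast
    then show ?thesis using x \<open>x1 < x2\<close> by (auto simp: lattice_bar_def)
  qed
qed

section \<open>Rooting a tree\<close>

text \<open>Every edge is a bridge: a path from \<open>u\<close> to \<open>v\<close> other than the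
  edge itself would close up with the arc \<open>(v, u)\<close> to a cycle of length at least
  3.\<close>

lemma (in pair_graph) tree_arc_in_walk:
  assumes tree: "undirected_tree G" and arc: "(u, v) \<in> parcs G" and walk: "awalk u q v"
  shows "(u, v) \<in> set q"
proof -
  define s where "s = awalk_to_apath q"
  have s: "apath u s v" "set s \<subseteq> set q"
    unfolding s_def using apath_awalk_to_apath[OF walk] awalk_to_apath_subset[OF walk] by auto
  have "u \<noteq> v" using arc no_loops' by blast
  have ws: "awalk u s v" using s(1) by (rule awalkI_apath)
  have wsr: "awalk u (s @ [(v, u)]) u"
    using ws arc arcs_symmetric by (auto intro!: awalk_appendI[of u s v] simp: awalk_simps wellformed')
  have "s \<noteq> []" using ws \<open>u \<noteq> v\<close> by (auto simp: awalk_Nil_iff)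
  \<comment> \<open>Without its head, the vertex list of the closed walk is that of \<open>s\<close>
    with the first entry \<open>u\<close> rotated to the end.\<close>
  have "distinct (tl (awalk_verts u (s @ [(v, u)])))"
  proof -
    have "awalk_verts u (s @ [(v, u)]) = awalk_verts u s @ [u]"
      using awalk_verts_append[OF wsr] by simp
    moreover have "distinct (awalk_verts u s)" using s(1) by (simp add: apath_def)
    moreover have "awalk_verts u s = u # tl (awalk_verts u s)"
      using ws by (cases s) (auto simp: awalk_simps)
    ultimately show ?thesis by (metis distinct1_rotate rotate1.simps(2) list.sel(3) append_Cons)
  qed
  then have "cycle (s @ [(v, u)])" unfolding cycle_def using wsr by blast
  \<comment> \<open>Cycles of length 2 only go back and forth along one edge and are permitted; the
    closing arc thus leaves at most one arc for \<open>s\<close>.\<close>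
  then have "length s < 2" using tree unfolding undirected_tree_def by fastforce
  then obtain e where "s = [e]" using \<open>s \<noteq> []\<close> by (cases s) auto
  then have "s = [(u, v)]" using ws by (cases e) (auto simp: awalk_simps)
  then show ?thesis using s(2) by auto
qed

text \<open>Depth is the distance to \<open>r\<close>, and the parent is a neighbour one step
  closer. Parent arcs, taken in both directions, already join any two vertices, so the bridge
  property leaves no room for other arcs.\<close>

lemma tree_rooting:
  assumes tree: "undirected_tree T" and r: "r \<in> pverts T"
  obtains p :: "'a \<Rightarrow> 'a" and depth :: "'a \<Rightarrow> nat"
  where "\<And>w. w \<in> pverts T \<Longrightarrow> w \<noteq> r \<Longrightarrow> p w \<in> pverts T \<and> depth w = Suc (depth (p w))"
    and "parcs T = (\<Union>w\<in>pverts T - {r}. {(w, p w), (p w, w)})"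
proof -
  interpret pair_graph T using tree by (simp add: undirected_tree_def)
  have conn: "\<exists>q. awalk w q r" if "w \<in> pverts T" for w
  proof -
    have "strongly_connected (with_proj T)"
      using tree symmetric_connected_imp_strongly_connected pair_sym_arcs
      by (simp add: undirected_tree_def)
    then show ?thesis using that r reachable_awalk by (auto simp: strongly_connected_def)
  qed
  define depth where "depth w = (LEAST n. \<exists>q. awalk w q r \<and> length q = n)" for w
  have depth_walk: "\<exists>q. awalk w q r \<and> length q = depth w" if "w \<in> pverts T" for w
    unfolding depth_def using LeastI_ex[of "\<lambda>n. \<exists>q. awalk w q r \<and> length q = n"] conn[OF that] by blast
  have depth_le: "depth w \<le> length q" if "awalk w q r" for w q
    unfolding depth_def using that by (intro Least_le) blast
  have "\<exists>z. (w, z) \<in> parcs T \<and> depth w = Suc (depth z)" if w: "w \<in> pverts T" "w \<noteq> r" for w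
  proof -
    obtain q where q: "awalk w q r" "length q = depth w" using depth_walk[OF w(1)] by blast
    then obtain e q' where e: "q = e # q'" using w(2) by (cases q) (auto simp: awalk_simps)
    then have e': "(w, snd e) \<in> parcs T" "awalk (snd e) q' r"
      using q(1) by (auto simp: awalk_simps)
    then have "snd e \<in> pverts T" using wellformed' by blast
    then obtain q'' where "awalk (snd e) q'' r" "length q'' = depth (snd e)"
      using depth_walk by blast
    then have "depth w \<le> Suc (depth (snd e))"
      using depth_le[of w "(w, snd e) # q''"] e'(1) by (auto simp: awalk_simps)
    moreover have "depth (snd e) \<le> length q'" using e'(2) by (rule depth_le)
    ultimately have "depth w = Suc (depth (snd e))" using q(2) e by simp
    then show ?thesis using e'(1) by blast
  qed
  then obtain p where p: "\<And>w. w \<in> pverts T \<Longrightarrow> w \<noteq> r \<Longrightarrow> (w, p w) \<in> parcs T \<and> depth w = Suc (depth (p w))"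
    by metis
  define P where "P = (\<Union>w\<in>pverts T - {r}. {(w, p w), (p w, w)})"
  have P_sub: "P \<subseteq> parcs T" unfolding P_def using p arcs_symmetric by blast
  have walk_up: "\<exists>q. awalk w q r \<and> set q \<subseteq> P" if "w \<in> pverts T" for w
    using that
  proof (induction "depth w" arbitrary: w rule: less_induct)
    case less
    show ?case
    proof (cases "w = r")
      case True
      then show ?thesis using r by (intro exI[of _ "[]"]) (simp add: awalk_Nil_iff)
    next
      case False
      then have pw: "(w, p w) \<in> parcs T" "depth (p w) < depth w" using p less.prems by auto
      then obtain q where "awalk (p w) q r" "set q \<subseteq> P"
        using less.hyps wellformed' by blast
      then show ?thesis using pw(1) False less.prems
        by (intro exI[of _ "(w, p w) # q"]) (auto simp: awalk_simps P_def)
    qed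
  qed
  have rev_P: "set (rev_path q) \<subseteq> P" if "set q \<subseteq> P" for q
    using that by (induction q) (auto simp: P_def)
  have "parcs T \<subseteq> P"
  proof
    fix e assume e: "e \<in> parcs T"
    obtain u v where uv: "e = (u, v)" by fastforce
    then have V: "u \<in> pverts T" "v \<in> pverts T" using e wellformed' by auto
    obtain q q' where q: "awalk u q r" "set q \<subseteq> P" "awalk v q' r" "set q' \<subseteq> P"
      using walk_up V by meson
    \<comment> \<open>Climb from \<open>u\<close> to the root and descend to \<open>v\<close>: this
      walk stays inside \<open>P\<close> and must contain the arc.\<close>
    then have "awalk u (q @ rev_path q') v" by (intro awalk_appendI[of u q r]) simp_all
    then have "(u, v) \<in> set (q @ rev_path q')" using tree_arc_in_walk[OF tree] e uv by blast
    then show "e \<in> P" using q rev_P uv by auto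
  qed
  then have "parcs T = P" using P_sub by blast
  then show thesis using that[of p depth] p wellformed' unfolding P_def by blast
qed

section \<open>Decomposition into spiders\<close>

text \<open>Each edge is identified with its lower endpoint, so non-root vertices stand for edges.
  \<open>rank\<close> numbers the children of every vertex from 0 and thereby fixes how the edges
  below it are distributed to spiders.\<close>

locale ranked_tree = pair_graph T for T :: "'a pair_pre_digraph" +
  fixes r :: 'a and p :: "'a \<Rightarrow> 'a" and depth rank :: "'a \<Rightarrow> nat"
  assumes tree: "undirected_tree T"
    and parent_in_verts: "\<And>w. w \<in> pverts T - {r} \<Longrightarrow> p w \<in> pverts T"
    and depth_parent: "\<And>w. w \<in> pverts T - {r} \<Longrightarrow> depth w = Suc (depth (p w))"
    and parcs_eq: "parcs T = (\<Union>w\<in>pverts T - {r}. {(w, p w), (p w, w)})"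
    and rank_inj: "\<And>v. inj_on rank {w \<in> pverts T - {r}. p w = v}"
    and rank_less: "\<And>w. w \<in> pverts T - {r} \<Longrightarrow>
      rank w < card {w' \<in> pverts T - {r}. p w' = p w}"
begin

definition children :: "'a \<Rightarrow> 'a set" where
  "children v = {w \<in> pverts T - {r}. p w = v}"

text \<open>
  Slot 2 continues the leg that enters the parent from above; slots \<open>3 * g, 3 * g + 1, 3 * g + 2\<close>
  with \<open>g \<ge> 1\<close> are the legs of the \<open>g\<close>-th spider centred at the parent. Nothing enters the root, so
  its slots start at 3.
\<close>

definition slot :: "'a \<Rightarrow> nat" where
  "slot w = rank w + (if p w = r then 3 else 2)"

text \<open>The first argument is fuel. In \<open>origin\<close>, \<open>depth w\<close> units
  suffice, because each step upwards lowers the depth by one.\<close>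

primrec climb :: "nat \<Rightarrow> 'a \<Rightarrow> 'a" where
  "climb 0 w = w"
| "climb (Suc n) w = (if slot w < 3 then climb n (p w) else w)"

text \<open>The topmost edge of the leg through \<open>w\<close>, given by its lower endpoint. Its
  slot carries both the group number and the leg number.\<close>

definition origin :: "'a \<Rightarrow> 'a" where
  "origin w = climb (depth w) w"

definition key :: "'a \<Rightarrow> 'a \<times> nat" where
  "key w = (p (origin w), slot (origin w) div 3)"

definition leg :: "'a \<Rightarrow> nat" where
  "leg w = slot (origin w) mod 3"

definition keys :: "('a \<times> nat) set" where
  "keys = key ` (pverts T - {r})"

text \<open>The centre is left out, so that members correspond to the edges of the spider.\<close>

definition members :: "'a \<times> nat \<Rightarrow> 'a set" where
  "members k = {w \<in> pverts T - {r}. key w = k}"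

definition spider :: "'a \<times> nat \<Rightarrow> 'a pair_pre_digraph" where
  "spider k = \<lparr>pverts = insert (fst k) (members k), parcs = (\<Union>w\<in>members k. {(w, p w), (p w, w)})\<rparr>"

section \<open>Legs of a spider are paths descending from its centre\<close>

lemma finite_keys: "finite keys"
  unfolding keys_def using pair_finite_verts by blast

lemma origin_start: "slot w \<ge> 3 \<Longrightarrow> origin w = w"
  unfolding origin_def by (cases "depth w") auto

text \<open>Slots at the root start at 3, so a slot below 3 means that the parent has an edge above
  it to continue.\<close>

lemma origin_continue:
  assumes "w \<in> pverts T - {r}" "slot w < 3"
  shows "origin w = origin (p w)" "p w \<in> pverts T - {r}"
proof -
  show "origin w = origin (p w)"
    unfolding origin_def using depth_parent[OF assms(1)] assms(2) by simp
  show "p w \<in> pverts T - {r}"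
    using parent_in_verts[OF assms(1)] assms(2) by (auto simp: slot_def split: if_splits)
qed

lemma origin_in:
  assumes "w \<in> pverts T - {r}"
  shows "origin w \<in> pverts T - {r} \<and> slot (origin w) \<ge> 3 \<and> depth (origin w) \<le> depth w"
  using assms
proof (induction "depth w" arbitrary: w rule: less_induct)
  case less
  show ?case
  proof (cases "slot w < 3")
    case True
    then show ?thesis
      using less.hyps[of "p w"] origin_continue[OF less.prems True] depth_parent[OF less.prems]
      by simp
  next
    case False
    then show ?thesis using less.prems origin_start[of w] by simp
  qed
qed

text \<open>An edge either starts a leg at the centre or prolongs the leg of its parent. The only
  slot below 3 is 2, taken by the child of rank 0 at a non-root vertex.\<close>

lemma member_cases [consumes 1, case_names start continue]:
  assumes "w \<in> members k"
  obtains "origin w = w" "p w = fst k" "slot w div 3 = snd k" "leg w = slot w mod 3" "slot w \<ge> 3"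
  | "slot w = 2" "p w \<in> members k" "leg (p w) = leg w" "origin w = origin (p w)"
proof (cases "slot w < 3")
  case True
  have w: "w \<in> pverts T - {r}" "key w = k" using assms by (auto simp: members_def)
  have "slot w = 2" using True by (auto simp: slot_def split: if_splits)
  then show ?thesis using that(2) origin_continue[OF w(1) True] w(2)
    by (auto simp: members_def key_def leg_def)
next
  case False
  then show ?thesis using that(1) origin_start[of w] assms
    by (auto simp: members_def key_def leg_def)
qed

lemma member_depth:
  assumes "w \<in> members k"
  shows "depth (origin w) = Suc (depth (fst k))" "depth (fst k) < depth w"
proof -
  have w: "w \<in> pverts T - {r}" "p (origin w) = fst k" using assms by (auto simp: members_def key_def)
  show "depth (origin w) = Suc (depth (fst k))"
    using origin_in[OF w(1)] depth_parent[of "origin w"] w(2) by simp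
  then show "depth (fst k) < depth w" using origin_in[OF w(1)] by simp
qed

lemma centre_not_member: "fst k \<notin> members k"
  using member_depth(2)[of "fst k" k] by blast

text \<open>Induction along the leg. Two starting edges with the same group and leg have the same
  slot at the same centre; two continuing edges have equal parents by induction and both have slot
  2.\<close>

lemma member_unique:
  assumes "w \<in> members k" "w' \<in> members k" "leg w = leg w'" "depth w = depth w'"
  shows "w = w'"
  using assms
proof (induction "depth w" arbitrary: w w' rule: less_induct)
  case less
  have V: "w \<in> pverts T - {r}" "w' \<in> pverts T - {r}"
    using less.prems by (auto simp: members_def)
  have same: "w = w'" if "p w = p w'" "slot w = slot w'"
  proof -
    have "rank w = rank w'" using that by (simp add: slot_def)
    then show ?thesis using inj_onD[OF rank_inj[of "p w"], of w w'] V that(1) by simp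
  qed
  \<comment> \<open>A starting edge lies exactly one level below the centre, a continuing edge
    strictly deeper.\<close>
  have no_mix: False if a: "a \<in> members k" "origin a = a" and b: "b \<in> members k" "origin b = origin (p b)"
    "p b \<in> members k" and "depth a = depth b" for a b
  proof -
    have "depth (origin (p b)) \<le> depth (p b)" using origin_in b(3) by (simp add: members_def)
    moreover have "depth b = Suc (depth (p b))" using b(1) depth_parent by (simp add: members_def)
    ultimately show False using that member_depth(1)[OF a(1)] member_depth(1)[OF b(1)] by simp
  qed
  from less.prems(1) show ?case
  proof (cases rule: member_cases)
    case start
    from less.prems(2) show ?thesis
    proof (cases rule: member_cases)
      case start': start
      \<comment> \<open>Group and leg are quotient and remainder of the slot modulo 3, so together
        they determine it.\<close>
      then have "slot w = slot w'" using start less.prems(3) by (metis div_mult_mod_eq)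
      then show ?thesis using same start start' by simp
    next
      case continue
      then show ?thesis using no_mix[of w w'] start less.prems by simp
    qed
  next
    case continue
    from less.prems(2) show ?thesis
    proof (cases rule: member_cases)
      case start
      then show ?thesis using no_mix[of w' w] continue less.prems by simp
    next
      case continue': continue
      have "p w = p w'"
      proof (rule less.hyps)
        show "depth (p w) < depth w" "depth (p w) = depth (p w')"
          using depth_parent[OF V(1)] depth_parent[OF V(2)] less.prems(4) by linarith+
        show "leg (p w) = leg (p w')" using continue(3) continue'(3) less.prems(3) by metis
      qed (fact continue(2) continue'(2))+
      then show ?thesis using same continue(1) continue'(1) by simp
    qed
  qed
qed

text \<open>Truncated subtraction is harmless, since members lie strictly deeper than the
  centre.\<close>

definition height :: "'a \<times> nat \<Rightarrow> 'a \<Rightarrow> nat" where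
  "height k v = depth v - depth (fst k)"

lemma height_centre [simp]: "height k (fst k) = 0"
  by (simp add: height_def)

lemma height_member: "w \<in> members k \<Longrightarrow> height k w > 0"
  using member_depth(2) by (simp add: height_def)

lemma height_parent:
  assumes "w \<in> members k"
  shows "height k w = Suc (height k (p w))"
proof -
  have "depth w = Suc (depth (p w))" using assms depth_parent by (simp add: members_def)
  then show ?thesis using member_depth(2)[OF assms] by (simp add: height_def)
qed

lemma parent_member:
  assumes "w \<in> members k"
  shows "p w = fst k \<and> height k w = 1 \<or> p w \<in> members k \<and> leg (p w) = leg w"
  using assms
proof (cases rule: member_cases)
  case start
  then show ?thesis using height_parent[OF assms] height_centre[of k] by simp
qed simp

lemma member_unique_height:
  assumes "w \<in> members k" "w' \<in> members k" "leg w = leg w'" "height k w = height k w'"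
  shows "w = w'"
proof -
  have "depth w = depth w'"
    using assms(4) member_depth(2)[OF assms(1)] member_depth(2)[OF assms(2)] by (simp add: height_def)
  then show ?thesis using member_unique assms(1-3) by blast
qed

lemma leg_less: "leg w < 3"
  by (simp add: leg_def)

section \<open>Coordinates of the bars\<close>

definition index :: "'a \<times> nat \<Rightarrow> nat" where
  "index = (SOME f. inj_on f keys)"

lemma index_inj: "inj_on index keys"
  unfolding index_def
proof (rule someI_ex[of "\<lambda>f. inj_on f keys"])
  show "\<exists>f::'a \<times> nat \<Rightarrow> nat. inj_on f keys"
    using finite_imp_inj_to_nat_seg[OF finite_keys] by blast
qed

text \<open>
  Leg 0 is stacked above the centre. Legs 1 and 2 go downwards, shifted so that both overlap the
  centre but not each other. Bars of different spiders have horizontal distance more than 1.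
\<close>

definition offset :: "'a \<times> nat \<Rightarrow> 'a \<Rightarrow> real" where
  "offset k v = (if v = fst k \<or> leg v = 0 then 0 else if leg v = 1 then - 3 / 5 else 3 / 5)"

definition hpos :: "'a \<times> nat \<Rightarrow> 'a \<Rightarrow> real" where
  "hpos k v = 3 * real (index k) + offset k v"

text \<open>At the centre both branches give 0. The value of \<open>leg\<close> there does not refer
  to the spider \<open>k\<close>, which is why \<open>offset\<close> tests for the centre
  explicitly.\<close>

definition vpos :: "'a \<times> nat \<Rightarrow> 'a \<Rightarrow> int" where
  "vpos k v = (if leg v = 0 then int (height k v) else - int (height k v))"

text \<open>Columns are at least 3 apart and offsets shift each bar by at most 3/5, which leaves a
  distance of at least 9/5.\<close>

lemma hpos_diff_keys:
  assumes "k \<in> keys" "k' \<in> keys" "k \<noteq> k'"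
  shows "\<bar>hpos k v - hpos k' v'\<bar> > 1"
proof -
  have "index k \<noteq> index k'" using assms index_inj by (auto simp: inj_on_def)
  then consider "real (index k) + 1 \<le> real (index k')" | "real (index k') + 1 \<le> real (index k)"
    by linarith
  moreover have "\<bar>offset k v\<bar> \<le> 3 / 5" "\<bar>offset k' v'\<bar> \<le> 3 / 5"
    by (auto simp: offset_def)
  ultimately show ?thesis unfolding hpos_def by cases linarith+
qed

lemma verts_spider: "pverts (spider k) = insert (fst k) (members k)"
  by (simp add: spider_def)

lemma arcs_spider: "parcs (spider k) = (\<Union>w\<in>members k. {(w, p w), (p w, w)})"
  by (simp add: spider_def)

lemma arc_in_spider:
  assumes "(u, v) \<in> parcs (spider k)"
  shows "u \<in> pverts (spider k)" "v \<in> pverts (spider k)"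
proof -
  obtain w where "w \<in> members k" "(u, v) = (w, p w) \<or> (u, v) = (p w, w)"
    using assms by (auto simp: arcs_spider)
  then show "u \<in> pverts (spider k)" "v \<in> pverts (spider k)"
    using parent_member[of w k] unfolding verts_spider by blast+
qed

text \<open>Offset and vertical direction are constant along a leg; between the centre and the first
  vertex of a leg the offset changes by at most 3/5.\<close>

lemma pos_parent:
  assumes "w \<in> members k"
  shows "\<bar>hpos k w - hpos k (p w)\<bar> < 1" "\<bar>vpos k w - vpos k (p w)\<bar> = 1"
  using parent_member[OF assms] height_parent[OF assms] 
  by (auto simp: hpos_def vpos_def offset_def)

lemma pos_arc:
  assumes "(u, v) \<in> parcs (spider k)"
  shows "\<bar>hpos k u - hpos k v\<bar> < 1" "\<bar>vpos k u - vpos k v\<bar> = 1"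
  using assms pos_parent[of _ k] by (auto simp: arcs_spider abs_minus_commute)

lemma hpos_leg:
  "w \<in> members k \<Longrightarrow> w' \<in> members k \<Longrightarrow> leg w = leg w' \<Longrightarrow> hpos k w = hpos k w'"
  using centre_not_member[of k] by (auto simp: hpos_def offset_def)

lemma pos_disjoint:
  assumes "k \<in> keys" "k' \<in> keys" "v \<in> pverts (spider k)" "v' \<in> pverts (spider k')" "(v, k) \<noteq> (v', k')"
  shows "vpos k v \<noteq> vpos k' v' \<or> \<bar>hpos k v - hpos k' v'\<bar> > 1"
proof (cases "k = k'")
  case False
  then show ?thesis using hpos_diff_keys assms by blast
next
  case True
  consider "v = fst k" "v' \<in> members k" | "v \<in> members k" "v' = fst k"
    | "v \<in> members k" "v' \<in> members k" "leg v = leg v'" "height k v \<noteq> height k v'"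
    | "v \<in> members k" "v' \<in> members k" "leg v \<noteq> leg v'"
    using assms(3-5) True member_unique_height[of v k v'] unfolding verts_spider by blast
  then show ?thesis
  proof cases
    \<comment> \<open>Leg 0 lies above the centre and the others below it; legs 1 and 2 may reach
      the same level but are 6/5 apart.\<close>
    case 4
    then show ?thesis
      using True leg_less[of v] leg_less[of v'] centre_not_member[of k] height_member[of v k] height_member[of v' k]
      by (auto simp: vpos_def hpos_def offset_def)
  qed (use True height_member[of v k] height_member[of v' k] in \<open>auto simp: vpos_def\<close>)
qed

text \<open>
  Two bars on opposite sides of the centre are separated by it; otherwise the predecessor of the
  farther bar on its leg blocks the view.
\<close>

lemma pos_blocked:
  assumes "u \<in> pverts (spider k)" "v \<in> pverts (spider k)" "u \<noteq> v" "(u, v) \<notin> parcs (spider k)"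
    and "\<bar>hpos k u - hpos k v\<bar> < 1"
  obtains w where "w \<in> pverts (spider k)" "hpos k w = hpos k u \<or> hpos k w = hpos k v"
    "min (vpos k u) (vpos k v) < vpos k w" "vpos k w < max (vpos k u) (vpos k v)"
proof -
  define blocked where "blocked u v \<longleftrightarrow> (\<exists>w\<in>pverts (spider k). (hpos k w = hpos k u \<or> hpos k w = hpos k v) \<and>
    min (vpos k u) (vpos k v) < vpos k w \<and> vpos k w < max (vpos k u) (vpos k v))" for u v
  have sym: "blocked u v \<longleftrightarrow> blocked v u" for u v
    unfolding blocked_def by (simp only: min.commute max.commute disj_commute)
  have arcs_sym: "(u, v) \<in> parcs (spider k) \<longleftrightarrow> (v, u) \<in> parcs (spider k)" for u v
    by (auto simp: arcs_spider)
  have centre: "blocked (fst k) v" if v: "v \<in> members k" "(fst k, v) \<notin> parcs (spider k)" for v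
  proof -
    have "p v \<noteq> fst k" using v by (auto simp: arcs_spider)
    then have pv: "p v \<in> members k" "leg (p v) = leg v" using parent_member[OF v(1)] by auto
    then show ?thesis
      unfolding blocked_def
      using hpos_leg[OF pv(1) v(1)] height_parent[OF v(1)] height_member[OF pv(1)]
      by (intro bexI[of _ "p v"]) (auto simp: vpos_def verts_spider)
  qed
  have same_leg: "blocked u v"
    if u: "u \<in> members k" and v: "v \<in> members k" "leg u = leg v" "height k u < height k v"
      "(u, v) \<notin> parcs (spider k)" for u v
  proof -
    have "p v \<noteq> fst k" using height_parent[OF v(1)] height_member[OF u] v(3) by auto
    then have pv: "p v \<in> members k" "leg (p v) = leg v" using parent_member[OF v(1)] by auto
    have "u \<noteq> p v" using v by (auto simp: arcs_spider)
    \<comment> \<open>As \<open>u\<close> is not the parent of \<open>v\<close>, uniqueness on a leg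
      puts \<open>p v\<close> strictly between them.\<close>
    then have "height k u \<noteq> height k (p v)" using member_unique_height u pv v(2) by metis
    then show ?thesis
      unfolding blocked_def
      using hpos_leg[OF pv(1) v(1)] height_parent[OF v(1)] v pv
      by (intro bexI[of _ "p v"]) (auto simp: vpos_def verts_spider)
  qed
  \<comment> \<open>The centre has the same offset as leg 0, so it is aligned with
    \<open>u\<close>.\<close>
  have opposite: "blocked u v" if "u \<in> members k" "v \<in> members k" "leg u = 0" "leg v \<noteq> 0" for u v
    unfolding blocked_def using that height_member[of u k] height_member[of v k] 
    by (intro bexI[of _ "fst k"]) (auto simp: vpos_def verts_spider hpos_def offset_def)
  consider "u = fst k" "v \<in> members k" | "u \<in> members k" "v = fst k"
    | "u \<in> members k" "v \<in> members k" "leg u = leg v" "height k u < height k v"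
    | "u \<in> members k" "v \<in> members k" "leg u = leg v" "height k v < height k u"
    | "u \<in> members k" "v \<in> members k" "leg u = 0" "leg v \<noteq> 0"
    | "u \<in> members k" "v \<in> members k" "leg u \<noteq> 0" "leg v = 0"
    | "u \<in> members k" "v \<in> members k" "leg u \<noteq> leg v" "leg u \<noteq> 0" "leg v \<noteq> 0"
    using assms(1-3) member_unique_height[of u k v] linorder_less_linear[of "height k u" "height k v"]
    unfolding verts_spider by (metis insertE)
  then have "blocked u v"
  proof cases
    case 1
    then show ?thesis using centre assms(4) by blast
  next
    case 2
    then have "blocked v u" using centre assms(4) arcs_sym by blast
    then show ?thesis using sym by blast
  next
    case 3
    then show ?thesis using same_leg assms(4) by blast
  next
    case 4
    then have "blocked v u" using same_leg assms(4) arcs_sym by simp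
    then show ?thesis using sym by blast
  next
    case 5
    then show ?thesis using opposite by blast
  next
    case 6
    then have "blocked v u" using opposite by blast
    then show ?thesis using sym by blast
  next
    case 7
    \<comment> \<open>These are legs 1 and 2, whose offsets differ by 6/5, against the assumed
      overlap.\<close>
    then have "\<bar>hpos k u - hpos k v\<bar> \<ge> 1"
      using leg_less[of u] leg_less[of v] centre_not_member[of k] by (auto simp: hpos_def offset_def)
    then show ?thesis using assms(5) by simp
  qed
  then show thesis using that unfolding blocked_def by blast
qed

section \<open>Visibility representation of a union of spiders\<close>

definition bars :: "('a \<times> nat) set \<Rightarrow> 'a \<Rightarrow> (real \<times> real) set set" where
  "bars K v = (\<lambda>k. lattice_bar (hpos k v) (vpos k v)) ` {k \<in> K. v \<in> pverts (spider k)}"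

text \<open>A vertex receives one bar in each spider of \<open>K\<close> containing it. The set
  \<open>K\<close> is kept general to cover both a single spider and the whole tree.\<close>

lemma unit_bar_rep_spiders:
  assumes K: "K \<subseteq> keys" and arcs: "parcs G = (\<Union>k\<in>K. parcs (spider k))"
    and verts: "\<And>k. k \<in> K \<Longrightarrow> pverts (spider k) \<subseteq> pverts G"
    and card: "\<And>v. v \<in> pverts G \<Longrightarrow> card {k \<in> K. v \<in> pverts (spider k)} \<le> t"
  shows "unit_bar_rep t G (bars K)"
proof -
  have fin: "finite K" using K finite_keys finite_subset by blast
  let ?B = "\<Union>w\<in>pverts G. bars K w"
  have in_B: "lattice_bar (hpos k w) (vpos k w) \<in> ?B" if "k \<in> K" "w \<in> pverts (spider k)" for k w
  proof -
    have "w \<in> pverts G" using verts that by blast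
    then show ?thesis using that unfolding bars_def by blast
  qed
  have fin_bars: "finite (bars K v)" for v using fin by (simp add: bars_def)
  have card_bars: "card (bars K v) \<le> t" if "v \<in> pverts G" for v
  proof -
    have "card (bars K v) \<le> card {k \<in> K. v \<in> pverts (spider k)}"
      unfolding bars_def using fin by (intro card_image_le) simp
    then show ?thesis using card[OF that] by simp
  qed
  have unit: "unit_bar b" if "b \<in> bars K v" for b v
    using that unit_bar_lattice_bar by (auto simp: bars_def)
  have disj: "b \<inter> c = {}"
    if b: "b \<in> bars K u" and c: "c \<in> bars K v" and ne: "(u, b) \<noteq> (v, c)" for u v b c
  proof -
    obtain k l where k: "k \<in> K" "u \<in> pverts (spider k)" "b = lattice_bar (hpos k u) (vpos k u)"
      and l: "l \<in> K" "v \<in> pverts (spider l)" "c = lattice_bar (hpos l v) (vpos l v)"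
      using b c by (auto simp: bars_def)
    have "(u, k) \<noteq> (v, l)" using ne k l by auto
    then have "vpos k u \<noteq> vpos l v \<or> \<bar>hpos k u - hpos l v\<bar> > 1"
      using k l K by (intro pos_disjoint) auto
    then show ?thesis unfolding k l by (rule lattice_bar_disjoint)
  qed
  have adj: "(u, v) \<in> parcs G \<longleftrightarrow> (\<exists>b\<in>bars K u. \<exists>c\<in>bars K v. sees ?B b c)"
    if ne: "u \<noteq> v" for u v
  proof
    assume "(u, v) \<in> parcs G"
    then obtain k where k: "k \<in> K" "(u, v) \<in> parcs (spider k)" using arcs by auto
    then have uv: "u \<in> pverts (spider k)" "v \<in> pverts (spider k)"
      using arc_in_spider by auto
    have "sees ?B (lattice_bar (hpos k u) (vpos k u)) (lattice_bar (hpos k v) (vpos k v))"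
      using pos_arc[OF k(2)] by (intro sees_lattice_barI) (auto simp: bars_def)
    then show "\<exists>b\<in>bars K u. \<exists>c\<in>bars K v. sees ?B b c"
      using k uv unfolding bars_def by blast
  next
    assume "\<exists>b\<in>bars K u. \<exists>c\<in>bars K v. sees ?B b c"
    then obtain k l where k: "k \<in> K" "u \<in> pverts (spider k)" and l: "l \<in> K" "v \<in> pverts (spider l)"
      and see: "sees ?B (lattice_bar (hpos k u) (vpos k u)) (lattice_bar (hpos l v) (vpos l v))"
      by (auto simp: bars_def)
    have near: "\<bar>hpos k u - hpos l v\<bar> < 1" using sees_lattice_barD(1)[OF see] .
    \<comment> \<open>Bars from different columns have no common abscissa and cannot see each
      other.\<close>
    have "k = l"
    proof (rule ccontr)
      assume "k \<noteq> l"
      then have "\<bar>hpos k u - hpos l v\<bar> > 1" using k l K by (intro hpos_diff_keys) auto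
      then show False using near by simp
    qed
    have "(u, v) \<in> parcs (spider k)"
    proof (rule ccontr)
      assume "(u, v) \<notin> parcs (spider k)"
      then obtain w where w: "w \<in> pverts (spider k)" "hpos k w = hpos k u \<or> hpos k w = hpos k v"
        "min (vpos k u) (vpos k v) < vpos k w" "vpos k w < max (vpos k u) (vpos k v)"
        using pos_blocked[of u k v] k l near \<open>k = l\<close> ne by metis
      then show False
        using sees_lattice_barD(3)[OF see in_B[OF k(1) w(1)]] \<open>k = l\<close> by auto
    qed
    then show "(u, v) \<in> parcs G" using arcs k by blast
  qed
  show ?thesis
    unfolding unit_bar_rep_def
    by (intro conjI ballI impI fin_bars card_bars unit disj adj) assumption+
qed

section \<open>Counting the spiders at a vertex\<close>

lemma out_degree_eq:
  assumes "v \<in> pverts T"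
  shows "out_degree (with_proj T) v = card (children v) + (if v = r then 0 else 1)"
proof -
  define N where "N = children v \<union> (if v = r then {} else {p v})"
  have fin: "finite (children v)" using pair_finite_verts by (simp add: children_def)
  have "p v \<notin> children v" if "v \<noteq> r"
    using that assms depth_parent[of v] depth_parent[of "p v"] by (auto simp: children_def)
  then have "card N = card (children v) + (if v = r then 0 else 1)"
    using fin by (simp add: N_def)
  moreover have "out_arcs (with_proj T) v = Pair v ` N"
    using assms by (auto simp: out_arcs_def parcs_eq N_def children_def)
  ultimately show ?thesis by (simp add: out_degree_def card_image inj_on_def)
qed

text \<open>A vertex lies in the spider containing its parent edge and in those centred at it. With
  \<open>c\<close> children the largest slot is at most \<open>c + 1\<close>, or
  \<open>c + 2\<close> at the root, which bounds the group numbers.\<close>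

lemma keys_at_vertex:
  "{k \<in> keys. v \<in> pverts (spider k)} \<subseteq> (if v = r then {} else {key v}) \<union>
    Pair v ` {1..(card (children v) + (if v = r then 2 else 1)) div 3}"
proof
  fix k assume "k \<in> {k \<in> keys. v \<in> pverts (spider k)}"
  then consider "v \<in> members k" | "k \<in> keys" "fst k = v" by (auto simp: verts_spider)
  then show "k \<in> (if v = r then {} else {key v}) \<union>
    Pair v ` {1..(card (children v) + (if v = r then 2 else 1)) div 3}"
  proof cases
    case 1
    then show ?thesis by (auto simp: members_def)
  next
    case 2
    then obtain w where w: "w \<in> pverts T - {r}" "k = key w" by (auto simp: keys_def)
    define u where "u = origin w"
    have u: "u \<in> pverts T - {r}" "slot u \<ge> 3" using origin_in[OF w(1)] by (auto simp: u_def)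
    have k: "k = (p u, slot u div 3)" using w(2) by (simp add: key_def u_def)
    then have "p u = v" using 2 by simp
    then have "slot u \<le> card (children v) + (if v = r then 2 else 1)"
      using rank_less[OF u(1)] by (cases "v = r") (simp_all add: slot_def children_def)
    then have "slot u div 3 \<le> (card (children v) + (if v = r then 2 else 1)) div 3"
      by (rule div_le_mono)
    moreover have "1 \<le> slot u div 3" using u(2) by simp
    ultimately show ?thesis using k \<open>p u = v\<close> by auto
  qed
qed

text \<open>For a non-root vertex the degree is \<open>c + 1\<close> with \<open>c\<close> children,
  and \<open>1 + (c + 1) div 3\<close> equals the bound; at the root \<open>(c + 2) div 3\<close> is
  within it.\<close>

lemma card_keys_at_vertex:
  assumes "v \<in> pverts T"
  shows "card {k \<in> keys. v \<in> pverts (spider k)} \<le> (out_degree (with_proj T) v + 3) div 3"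
proof -
  let ?n = "(card (children v) + (if v = r then 2 else 1)) div 3"
  have "card {k \<in> keys. v \<in> pverts (spider k)} \<le>
      card ((if v = r then {} else {key v}) \<union> Pair v ` {1..?n})"
    using keys_at_vertex by (rule card_mono[rotated]) simp
  also have "\<dots> \<le> card (if v = r then {} else {key v}) + card (Pair v ` {1..?n})"
    by (rule card_Un_le)
  also have "\<dots> = (if v = r then 0 else 1) + ?n"
    by (simp add: card_image inj_on_def)
  also have "\<dots> \<le> (out_degree (with_proj T) v + 3) div 3"
    using out_degree_eq[OF assms] by auto
  finally show ?thesis .
qed

section \<open>The spiders decompose the tree into UBVTs\<close>

lemma parcs_spiders: "(\<Union>k\<in>keys. parcs (spider k)) = parcs T"
  unfolding arcs_spider parcs_eq members_def keys_def by blast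

text \<open>Depth singles out the lower endpoint of an arc, and the lower endpoint determines the
  key.\<close>

lemma spider_arcs_disjoint:
  assumes "e \<in> parcs (spider k)" "e \<in> parcs (spider l)"
  shows "k = l"
proof -
  obtain w where w: "w \<in> members k" "e = (w, p w) \<or> e = (p w, w)"
    using assms(1) by (auto simp: arcs_spider)
  obtain u where u: "u \<in> members l" "e = (u, p u) \<or> e = (p u, u)"
    using assms(2) by (auto simp: arcs_spider)
  have "depth w = Suc (depth (p w))" "depth u = Suc (depth (p u))"
    using w u depth_parent by (auto simp: members_def)
  then have "w = u" using w u by auto
  then show ?thesis using w u by (simp add: members_def)
qed

lemma spider_verts_subset:
  assumes "k \<in> keys"
  shows "pverts (spider k) \<subseteq> pverts T"
proof -
  obtain w where w: "w \<in> pverts T - {r}" "k = key w" using assms by (auto simp: keys_def)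
  then have "fst k \<in> pverts T" using origin_in[OF w(1)] parent_in_verts by (simp add: key_def)
  then show ?thesis by (auto simp: verts_spider members_def)
qed

lemma pair_graph_spider:
  assumes "k \<in> keys"
  shows "pair_graph (spider k)"
proof
  have sub: "parcs (spider k) \<subseteq> parcs T" using parcs_spiders assms by blast
  show "fst e \<in> pverts (spider k)" "snd e \<in> pverts (spider k)" if "e \<in> parcs (spider k)" for e
    using that arc_in_spider[of "fst e" "snd e"] by auto
  show "finite (pverts (spider k))"
    using spider_verts_subset[OF assms] pair_finite_verts finite_subset by blast
  show "finite (parcs (spider k))" using sub pair_finite_arcs finite_subset by blast
  show "fst e \<noteq> snd e" if "e \<in> parcs (spider k)" for e
    using that sub pair_no_loops by blast
  show "symmetric (with_proj (spider k))"
    by (auto simp: symmetric_def sym_def arcs_spider)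
qed

lemma subgraph_spider:
  assumes "k \<in> keys"
  shows "subgraph (with_proj (spider k)) (with_proj T)"
proof -
  interpret S: pair_graph "spider k" using pair_graph_spider[OF assms] .
  have "parcs (spider k) \<subseteq> parcs T" using parcs_spiders assms by blast
  then show ?thesis
    using spider_verts_subset[OF assms] wf_digraph S.wf_digraph
    by (simp add: subgraph_def compatible_def)
qed

text \<open>Every member climbs through parents to the centre, and arcs can be reversed.\<close>

lemma connected_spider:
  assumes "k \<in> keys"
  shows "connected (with_proj (spider k))"
proof -
  interpret S: pair_graph "spider k" using pair_graph_spider[OF assms] .
  have up: "w \<rightarrow>\<^sup>*\<^bsub>with_proj (spider k)\<^esub> fst k" if "w \<in> members k" for w
    using that
  proof (induction "height k w" arbitrary: w rule: less_induct)
    case less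
    have arc: "(w, p w) \<in> parcs (spider k)" using less.prems by (auto simp: arcs_spider)
    show ?case
    proof (cases "p w = fst k")
      case True
      then show ?thesis using S.reachable_adjI[OF arc] by simp
    next
      case False
      then have "p w \<rightarrow>\<^sup>*\<^bsub>with_proj (spider k)\<^esub> fst k"
        using less.hyps[of "p w"] parent_member[OF less.prems] height_parent[OF less.prems] by simp
      then show ?thesis using S.adj_reachable_trans[OF arc] by blast
    qed
  qed
  have up': "w \<rightarrow>\<^sup>*\<^bsub>with_proj (spider k)\<^esub> fst k" if "w \<in> pverts (spider k)" for w
    using that up by (auto simp: verts_spider)
  have "strongly_connected (with_proj (spider k))"
  proof (rule strongly_connectedI)
    show "verts (with_proj (spider k)) \<noteq> {}" by (simp add: verts_spider)
    fix u v assume "u \<in> verts (with_proj (spider k))" "v \<in> verts (with_proj (spider k))"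
    then show "u \<rightarrow>\<^sup>*\<^bsub>with_proj (spider k)\<^esub> v"
      using up' S.symmetric_reachable'[of v "fst k"] S.reachable_trans[of u "fst k" v] by simp
  qed
  then show ?thesis
    using S.reachable_mk_symmetricI by (simp add: connected_def strongly_connected_def)
qed

lemma ubvt_spider:
  assumes "k \<in> keys"
  shows "ubvt (spider k)"
proof -
  have "unit_bar_rep 1 (spider k) (bars {k})"
  proof (rule unit_bar_rep_spiders)
    show "card {k' \<in> {k}. v \<in> pverts (spider k')} \<le> 1" for v
    proof -
      have "{k' \<in> {k}. v \<in> pverts (spider k')} \<subseteq> {k}" by blast
      from card_mono[OF _ this] show ?thesis by simp
    qed
  qed (use assms in auto)
  \<comment> \<open>A long cycle in the spider would also be a cycle in \<open>T\<close>.\<close>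
  moreover have "undirected_tree (spider k)"
    using tree pair_graph_spider connected_spider subgraph_cycle[OF subgraph_spider] assms
    unfolding undirected_tree_def by blast
  ultimately show ?thesis unfolding ubvt_def by blast
qed

lemma ubvt_decomposition_spiders: "ubvt_decomposition (spider ` keys) T"
  unfolding ubvt_decomposition_def
proof (intro conjI ballI)
  fix H assume "H \<in> spider ` keys"
  then obtain k where "H = spider k" "k \<in> keys" by (rule imageE)
  then show "subgraph (with_proj H) (with_proj T)" "ubvt H" using subgraph_spider ubvt_spider by simp_all
next
  show "disjoint_family_on parcs (spider ` keys)"
    unfolding disjoint_family_on_def
  proof (intro ballI impI)
    fix H H' assume H: "H \<in> spider ` keys" "H' \<in> spider ` keys" "H \<noteq> H'"
    obtain k where k: "H = spider k" using H(1) by (rule imageE)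
    obtain l where l: "H' = spider l" using H(2) by (rule imageE)
    have "k \<noteq> l" using H(3) k l by metis
    then show "parcs H \<inter> parcs H' = {}" using spider_arcs_disjoint[of _ k l] unfolding k l by blast
  qed
  show "(\<Union>H\<in>spider ` keys. parcs H) = parcs T" using parcs_spiders unfolding image_image .
qed

lemma unit_bar_rep_tree:
  assumes "\<And>v. v \<in> pverts T \<Longrightarrow> (out_degree (with_proj T) v + 3) div 3 \<le> t"
  shows "unit_bar_rep t T (bars keys)"
proof (rule unit_bar_rep_spiders)
  show "card {k \<in> keys. v \<in> pverts (spider k)} \<le> t" if "v \<in> pverts T" for v
    using card_keys_at_vertex[OF that] assms[OF that] by simp
qed (simp_all add: parcs_spiders spider_verts_subset)

end

section \<open>Ranking the children and concluding the bounds\<close>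

lemma undirected_tree_ranking:
  assumes "undirected_tree T"
  obtains r p depth rank where "ranked_tree T r p depth rank"
proof -
  interpret pair_graph T using assms by (simp add: undirected_tree_def)
  obtain r where r: "r \<in> pverts T"
    using assms by (auto simp: undirected_tree_def connected_conv)
  obtain p depth where p: "\<And>w. w \<in> pverts T \<Longrightarrow> w \<noteq> r \<Longrightarrow> p w \<in> pverts T \<and> depth w = Suc (depth (p w))"
    and arcs: "parcs T = (\<Union>w\<in>pverts T - {r}. {(w, p w), (p w, w)})"
    using tree_rooting[OF assms r] by blast
  let ?C = "\<lambda>v. {w \<in> pverts T - {r}. p w = v}"
  have "\<exists>f. bij_betw f (?C v) {0..<card (?C v)}" for v
    using pair_finite_verts by (intro ex_bij_betw_finite_nat) simp
  then have "\<forall>v. \<exists>f. bij_betw f (?C v) {0..<card (?C v)}" by blast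
  from choice[OF this] obtain f where f: "\<And>v. bij_betw (f v) (?C v) {0..<card (?C v)}" by blast
  \<comment> \<open>The numberings chosen separately below each vertex are glued by consulting the
    one at the parent.\<close>
  define rank where "rank w = f (p w) w" for w
  have "ranked_tree T r p depth rank"
  proof
    show "p w \<in> pverts T" "depth w = Suc (depth (p w))" if "w \<in> pverts T - {r}" for w
      using p[of w] that by simp_all
    show "inj_on rank (?C v)" for v
    proof (rule inj_onI)
      fix x y assume "x \<in> ?C v" "y \<in> ?C v" "rank x = rank y"
      then show "x = y"
        using inj_onD[OF bij_betw_imp_inj_on[OF f[of v]], of x y] by (simp add: rank_def)
    qed
    show "rank w < card (?C (p w))" if "w \<in> pverts T - {r}" for w
      using bij_betwE[OF f[of "p w"]] that by (simp add: rank_def)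
  qed (fact assms arcs)+
  then show thesis by (rule that)
qed

text \<open>Translates the stated bound into the natural-number division in which the counting is
  done.\<close>

lemma ceiling_third: "\<lceil>(real d + 1) / 3\<rceil> = int ((d + 3) div 3)"
proof -
  have "(real d + 1) / 3 = real_of_int (int d + 1) / real_of_int 3" by simp
  also have "\<lceil>\<dots>\<rceil> = - (- (int d + 1) div 3)" by (rule ceiling_divide_eq_div)
  also have "\<dots> = int ((d + 3) div 3)" by (simp add: zdiv_int)
  finally show ?thesis .
qed

theorem theorem6:
  fixes T :: "'a pair_pre_digraph"
  assumes "undirected_tree T"
  shows "(\<exists>\<D>. ubvt_decomposition \<D> T \<and>
            (\<forall>v\<in>pverts T. int (card {H \<in> \<D>. v \<in> pverts H})
               \<le> \<lceil>(real (out_degree (with_proj T) v) + 1) / 3\<rceil>)) \<and>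
         ub T \<le> enat (nat \<lceil>(real (max_degree T) + 1) / 3\<rceil>)"
proof -
  obtain r p depth rank where "ranked_tree T r p depth rank"
    using undirected_tree_ranking[OF assms] by blast
  then interpret ranked_tree T r p depth rank .
  have "card {H \<in> spider ` keys. v \<in> pverts H} \<le> (out_degree (with_proj T) v + 3) div 3"
    if "v \<in> pverts T" for v
  proof -
    \<comment> \<open>Passing from keys to the subgraphs they name can only lower the count.\<close>
    have "{H \<in> spider ` keys. v \<in> pverts H} = spider ` {k \<in> keys. v \<in> pverts (spider k)}" by blast
    then have "card {H \<in> spider ` keys. v \<in> pverts H} \<le> card {k \<in> keys. v \<in> pverts (spider k)}"
      using finite_keys by (simp add: card_image_le)
    then show ?thesis using card_keys_at_vertex[OF that] by simp
  qed
  moreover have "unit_bar_rep ((max_degree T + 3) div 3) T (bars keys)"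
  proof (rule unit_bar_rep_tree)
    fix v assume "v \<in> pverts T"
    then have "out_degree (with_proj T) v \<le> max_degree T"
      unfolding max_degree_def using pair_finite_verts by (intro Max_ge) auto
    then show "(out_degree (with_proj T) v + 3) div 3 \<le> (max_degree T + 3) div 3"
      by (intro div_le_mono) simp
  qed
  then have "ub T \<le> enat ((max_degree T + 3) div 3)"
    unfolding ub_def by (intro INF_lower) blast
  ultimately show ?thesis
    using ubvt_decomposition_spiders unfolding ceiling_third nat_int of_nat_le_iff by blast
qed

end
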